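(* For all $k\geq2$, $$\mathcal{D}_{213\dots k}(x)=G_{k-1}(x)+xG_{k-2}(x).$$
   Context: A permutation $\pi$ is a Dumont permutation (of the first kind) if each even integer in $\pi$ is followed by a smaller integer, and each odd integer is either followed by a larger integer or is the last element of $\pi$. For a pattern $\tau$, $\mathcal{D}_\tau(x)=\sum_{n\geq0}\mathcal{D}_\tau(n)x^n$ where $\mathcal{D}_\tau(n)$ is the number of Dumont permutations of length $n$ avoiding both $132$ and $\tau$ (classical pattern avoidance). For $r\geq2$ consider $Q_r(x)=1+\frac{x^2Q_{r-1}(x)}{1-x^2Q_{r-2}(x)}$; $G_r(x)$ denotes its solution with $Q_0(x)=Q_1(x)=1$ (e.g. $G_2=\frac{1}{1-x^2}$). Here $213\dots k$ is the pattern $2134\cdots k$. *)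

theory Defs
  imports
    "HOL-Combinatorics.Multiset_Permutations"
    "HOL-Computational_Algebra.Formal_Power_Series"
    "HOL-Library.Sublist"
begin

definition order_isomorphic :: "nat list \<Rightarrow> nat list \<Rightarrow> bool" where
  "order_isomorphic xs ys \<longleftrightarrow>
     length xs = length ys \<and>
     (\<forall>i<length xs. \<forall>j<length xs. xs ! i < xs ! j \<longleftrightarrow> ys ! i < ys ! j)"

text \<open>Classical pattern avoidance: \<open>subseq\<close> is the relation of (not necessarily contiguous)
  subsequences.\<close>

definition avoids :: "nat list \<Rightarrow> nat list \<Rightarrow> bool" where
  "avoids \<pi> \<tau> \<longleftrightarrow> \<not> (\<exists>\<sigma>. subseq \<sigma> \<pi> \<and> order_isomorphic \<sigma> \<tau>)"

text \<open>Dumont permutations of the first kind, in one-line notation. An even entry must have a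
  successor, so it cannot be the last one.\<close>

definition dumont :: "nat list \<Rightarrow> bool" where
  "dumont \<pi> \<longleftrightarrow>
     (\<forall>i<length \<pi>.
        (even (\<pi> ! i) \<longrightarrow> Suc i < length \<pi> \<and> \<pi> ! Suc i < \<pi> ! i) \<and>
        (odd (\<pi> ! i) \<longrightarrow> Suc i = length \<pi> \<or> \<pi> ! i < \<pi> ! Suc i))"

definition dumont_count :: "nat list \<Rightarrow> nat \<Rightarrow> nat" where
  "dumont_count \<tau> n =
     card {\<pi> \<in> permutations_of_set {1..n}. dumont \<pi> \<and> avoids \<pi> [1, 3, 2] \<and> avoids \<pi> \<tau>}"

definition dumont_gf :: "nat list \<Rightarrow> rat fps" where
  "dumont_gf \<tau> = Abs_fps (\<lambda>n. of_nat (dumont_count \<tau> n))"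

text \<open>The denominators have constant coefficient \<open>1\<close>, so the division is by a unit of the
  ring of formal power series.\<close>

fun G :: "nat \<Rightarrow> rat fps" where
  "G 0 = 1"
| "G (Suc 0) = 1"
| "G (Suc (Suc r)) = 1 + fps_X\<^sup>2 * G (Suc r) / (1 - fps_X\<^sup>2 * G r)"

text \<open>The pattern \<open>2 1 3 4 \<dots> k\<close>, for \<open>k \<ge> 2\<close>; it is \<open>2 1\<close> when \<open>k = 2\<close>.\<close>

definition pattern_213 :: "nat \<Rightarrow> nat list" where
  "pattern_213 k = [2, 1] @ [3..<Suc k]"

end

theory Submission
  imports Defs
begin

text \<open>
  Write \<open>m = k - 2\<close> and split the permutation at its maximum. If the length is odd, a Dumont
  permutation ends with its maximum, and deleting it lowers \<open>m\<close> by one. If the length \<open>n\<close> is even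
  and positive, avoiding \<open>132\<close> forces the form \<open>\<alpha> n \<beta>\<close> with every entry of \<open>\<alpha>\<close> above every entry
  of \<open>\<beta>\<close>. Here \<open>\<beta>\<close> is a nonempty Dumont permutation, and if \<open>\<alpha>\<close> is nonempty its least entry must
  be odd, so \<open>\<beta>\<close> has even length and \<open>\<alpha>\<close> is a shifted Dumont permutation of odd length. For
  \<open>m \<ge> 1\<close> an occurrence of \<open>213\<dots>k\<close> lies inside \<open>\<alpha> n\<close> or inside \<open>\<beta>\<close>. With \<open>E\<^sub>m\<close>
  and \<open>O\<^sub>m\<close> the even and odd parts of the generating function this gives \<open>O\<^sub>m = x E\<^sub>m\<^sub>-\<^sub>1\<close> and
  \<open>E\<^sub>m = 1 + x O\<^sub>m + x O\<^sub>m\<^sub>-\<^sub>1 (E\<^sub>m - 1)\<close>, which is the recurrence of \<open>G\<close>.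
\<close>

unbundle fps_syntax

section \<open>The Dumont condition around a maximal entry and under shifts\<close>

lemma dumont_Nil: "dumont []"
  by (simp add: dumont_def)

lemma dumont_singleton: "dumont [x] \<longleftrightarrow> odd x"
  by (auto simp: dumont_def)

lemma dumont_Cons_Cons:
  "dumont (x # y # zs) \<longleftrightarrow> (if even x then y < x else x < y) \<and> dumont (y # zs)"
  unfolding dumont_def by (auto simp: All_less_Suc2 nth_Cons')

lemmas dumont_simps = dumont_Nil dumont_singleton dumont_Cons_Cons

text \<open>The last entry of \<open>xs\<close> is followed by the larger \<open>N\<close>, so it
  must be odd, and that is also the condition for ending \<open>xs\<close>. The even
  \<open>N\<close> needs a successor, and every entry of \<open>ys\<close> is small enough to be
  one.\<close>

lemma dumont_append_max_even:
  assumes "even N" "\<And>x. x \<in> set xs \<Longrightarrow> x < N" "\<And>y. y \<in> set ys \<Longrightarrow> y < N"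
  shows "dumont (xs @ N # ys) \<longleftrightarrow> dumont xs \<and> dumont ys \<and> ys \<noteq> []"
  using assms
proof (induction xs)
  case Nil
  then show ?case by (cases ys) (auto simp: dumont_simps)
next
  case (Cons x xs)
  then show ?case by (cases xs) (auto simp: dumont_simps split: if_splits)
qed

text \<open>An odd entry that is not last needs a larger successor, and the maximum has none. Before
  \<open>N\<close> the situation is as in the even case.\<close>

lemma dumont_append_max_odd:
  assumes "odd N" "\<And>x. x \<in> set xs \<Longrightarrow> x < N" "\<And>y. y \<in> set ys \<Longrightarrow> y < N"
  shows "dumont (xs @ N # ys) \<longleftrightarrow> dumont xs \<and> ys = []"
  using assms
proof (induction xs)
  case Nil
  then show ?case by (cases ys) (auto simp: dumont_simps dest: less_asym)
next
  case (Cons x xs)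
  then show ?case by (cases xs) (auto simp: dumont_simps split: if_splits)
qed

text \<open>Its use is the contrapositive: the least entry of a Dumont list is odd.\<close>

lemma dumont_even_has_smaller:
  assumes "dumont xs" "x \<in> set xs" "even x"
  shows "\<exists>y\<in>set xs. y < x"
proof -
  obtain i where i: "i < length xs" "xs ! i = x" using assms(2) by (auto simp: in_set_conv_nth)
  then have "Suc i < length xs \<and> xs ! Suc i < x" using assms(1,3) unfolding dumont_def by auto
  then show ?thesis using nth_mem by blast
qed

text \<open>An even shift keeps both the parities and the comparisons.\<close>

lemma dumont_shift:
  assumes "even j"
  shows "dumont (map ((+) j) xs) \<longleftrightarrow> dumont xs"
proof (induction xs rule: induct_list012)
  case (3 x y zs)
  then show ?case using assms by (simp add: dumont_simps)
qed (use assms in \<open>simp_all add: dumont_simps\<close>)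

section \<open>Containment of the pattern 213...k\<close>

lemma subseq_set: "subseq xs ys \<Longrightarrow> set xs \<subseteq> set ys"
  by (auto elim: list_emb_set)

lemma subseq_mapE:
  assumes "subseq us (map f xs)"
  obtains vs where "subseq vs xs" "us = map f vs"
  using assms by (metis nths_map subseq_conv_nths)

text \<open>The index \<open>m\<close> counts the letters after the initial descent, so the pattern
  has length \<open>m + 2\<close>. Comparisons of \<open>a\<close> with \<open>cs\<close> are left
  out because they follow through \<open>b\<close>.\<close>

definition contains_213 :: "nat \<Rightarrow> nat list \<Rightarrow> bool" where
  "contains_213 m xs \<longleftrightarrow>
     (\<exists>b a cs. length cs = m \<and> subseq (b # a # cs) xs \<and> a < b \<and> sorted_wrt (<) (b # cs))"

lemma order_isomorphic_pattern_213:
  "order_isomorphic s (pattern_213 (m + 2)) \<longleftrightarrow>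
     (\<exists>b a cs. s = b # a # cs \<and> length cs = m \<and> a < b \<and> sorted_wrt (<) (b # cs))"
proof
  have nth: "pattern_213 (Suc (Suc m)) ! 0 = 2" "pattern_213 (Suc (Suc m)) ! Suc 0 = 1"
    "\<And>i. i < m \<Longrightarrow> pattern_213 (Suc (Suc m)) ! Suc (Suc i) = i + 3"
    by (auto simp: pattern_213_def simp del: upt_Suc)
  have len: "length (pattern_213 (Suc (Suc m))) = Suc (Suc m)"
    by (simp add: pattern_213_def del: upt_Suc)
  {
    assume iso: "order_isomorphic s (pattern_213 (m + 2))"
    then have "length s = Suc (Suc m)" using len by (simp add: order_isomorphic_def)
    then obtain b a cs where s: "s = b # a # cs" and m: "length cs = m"
      by (auto simp: length_Suc_conv)
    have *: "s ! i < s ! j \<longleftrightarrow> pattern_213 (m + 2) ! i < pattern_213 (m + 2) ! j"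
      if "i < m + 2" "j < m + 2" for i j
      using iso that by (simp add: order_isomorphic_def len)
    have "a < b" using *[of 1 0] by (simp add: s nth)
    moreover have "b < cs ! i" if "i < m" for i
      using *[of 0 "i + 2"] that by (simp add: s nth)
    moreover have "cs ! i < cs ! j" if "i < j" "j < m" for i j
      using *[of "i + 2" "j + 2"] that by (simp add: s nth)
    then have "sorted_wrt (<) cs" using m by (simp add: sorted_wrt_iff_nth_less)
    ultimately show "\<exists>b a cs. s = b # a # cs \<and> length cs = m \<and> a < b \<and> sorted_wrt (<) (b # cs)"
      using s m by (auto simp: in_set_conv_nth)
  }
  assume "\<exists>b a cs. s = b # a # cs \<and> length cs = m \<and> a < b \<and> sorted_wrt (<) (b # cs)"
  then obtain b a cs where s: "s = b # a # cs" and m: "length cs = m" and ab: "a < b"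
    and b: "\<forall>c\<in>set cs. b < c" and cs: "sorted_wrt (<) cs" by auto
  have bc: "b < cs ! i" if "i < m" for i using that b m by auto
  have ac: "a < cs ! i" if "i < m" for i using bc[OF that] ab by simp
  have cc: "cs ! i < cs ! j \<longleftrightarrow> i < j" if "i < m" "j < m" for i j
    using that cs m unfolding sorted_wrt_iff_nth_less
    by (metis less_irrefl_nat less_not_sym linorder_neqE_nat)
  have "s ! i < s ! j \<longleftrightarrow> pattern_213 (m + 2) ! i < pattern_213 (m + 2) ! j"
    if "i < m + 2" "j < m + 2" for i j
  proof -
    have "i = 0 \<or> i = 1 \<or> (\<exists>i'<m. i = Suc (Suc i'))" using that(1) by presburger
    moreover have "j = 0 \<or> j = 1 \<or> (\<exists>j'<m. j = Suc (Suc j'))" using that(2) by presburger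
    ultimately show ?thesis
      using ab bc ac cc by (elim disjE exE conjE) (simp_all add: s nth not_less less_imp_le)
  qed
  then show "order_isomorphic s (pattern_213 (m + 2))"
    using m s by (simp add: order_isomorphic_def len)
qed

lemma avoids_pattern_213_iff: "avoids xs (pattern_213 (m + 2)) \<longleftrightarrow> \<not> contains_213 m xs"
  unfolding avoids_def order_isomorphic_pattern_213 contains_213_def by blast

lemma contains_213_Nil: "\<not> contains_213 m []"
  by (simp add: contains_213_def)

lemma contains_213_0: "contains_213 0 xs \<longleftrightarrow> (\<exists>b a. subseq [b, a] xs \<and> a < b)"
  by (auto simp: contains_213_def)

text \<open>Dropping the last letter of an occurrence leaves one inside \<open>xs\<close>, whether
  or not \<open>N\<close> was used. Conversely, \<open>N\<close> exceeds all entries of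
  \<open>xs\<close> and can serve as a new last letter.\<close>

lemma contains_213_snoc_max:
  assumes "\<And>x. x \<in> set xs \<Longrightarrow> x < N"
  shows "contains_213 (Suc m) (xs @ [N]) \<longleftrightarrow> contains_213 m xs"
proof
  assume "contains_213 (Suc m) (xs @ [N])"
  then obtain b a cs c where *: "length cs = m" "subseq ((b # a # cs) @ [c]) (xs @ [N])"
    "a < b" "sorted_wrt (<) (b # cs @ [c])"
    unfolding contains_213_def by (metis append_Cons length_Suc_conv_rev)
  from *(2) obtain us vs where uv: "(b # a # cs) @ [c] = us @ vs" "subseq us xs" "subseq vs [N]"
    unfolding subseq_append_iff by blast
  \<comment> \<open>At most the final letter \<open>c\<close> can be matched with \<open>N\<close>,
    so \<open>us\<close> is the whole occurrence or the occurrence without \<open>c\<close>.\<close>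
  then have "length vs \<le> 1" using list_emb_length[of _ vs "[N]"] by simp
  then consider "us = (b # a # cs) @ [c]" | "us = b # a # cs"
    using uv(1) by (cases vs rule: rev_cases) auto
  then have "subseq (b # a # cs) xs"
  proof cases
    case 1
    then show ?thesis
      using uv(2) subseq_rev_drop_many[OF subseq_order.refl] subseq_order.order_trans by metis
  qed (use uv(2) in simp)
  with * show "contains_213 m xs"
    unfolding contains_213_def by (auto simp: sorted_wrt_append)
next
  assume "contains_213 m xs"
  then obtain b a cs where *: "length cs = m" "subseq (b # a # cs) xs" "a < b"
    "sorted_wrt (<) (b # cs)"
    unfolding contains_213_def by blast
  have "set (b # a # cs) \<subseteq> set xs" using *(2) by (rule subseq_set)
  then have "sorted_wrt (<) (b # cs @ [N])" using *(4) assms by (auto simp: sorted_wrt_append)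
  moreover have "subseq (b # a # cs @ [N]) (xs @ [N])"
    using list_emb_append_mono[OF *(2) subseq_order.refl[of "[N]"]] by simp
  ultimately show "contains_213 (Suc m) (xs @ [N])"
    using * unfolding contains_213_def by (intro exI[of _ b] exI[of _ a] exI[of _ "cs @ [N]"]) auto
qed

lemma contains_213_mono: "contains_213 m xs \<Longrightarrow> subseq xs ys \<Longrightarrow> contains_213 m ys"
  unfolding contains_213_def using subseq_order.order_trans[of _ xs ys] by fast

text \<open>An occurrence that meets both blocks starts in \<open>xs\<close> and ends in
  \<open>ys\<close>, so its first letter exceeds its last. With at least one letter after the
  descent, the pattern demands the opposite. For index 0 the pattern is 21, which can straddle the
  blocks.\<close>

lemma contains_213_append:
  assumes "\<And>x y. x \<in> set xs \<Longrightarrow> y \<in> set ys \<Longrightarrow> y < x"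
  shows "contains_213 (Suc m) (xs @ ys) \<longleftrightarrow> contains_213 (Suc m) xs \<or> contains_213 (Suc m) ys"
proof
  assume "contains_213 (Suc m) (xs @ ys)"
  then obtain b a cs where *: "length cs = Suc m" "subseq (b # a # cs) (xs @ ys)" "a < b"
    "sorted_wrt (<) (b # cs)"
    unfolding contains_213_def by blast
  from *(2) obtain us vs where uv: "b # a # cs = us @ vs" "subseq us xs" "subseq vs ys"
    unfolding subseq_append_iff by blast
  show "contains_213 (Suc m) xs \<or> contains_213 (Suc m) ys"
  proof (cases "us = [] \<or> vs = []")
    case True
    then show ?thesis using uv * unfolding contains_213_def by (metis append.right_neutral append_Nil)
  next
    case False
    \<comment> \<open>This is where the index \<open>Suc m\<close> matters: the last letter of the
      occurrence lies in \<open>cs\<close> and exceeds \<open>b\<close>.\<close>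
    have "cs \<noteq> []" using *(1) by auto
    have "hd us = b" using uv(1) False by (metis hd_append2 list.sel(1))
    then have "b \<in> set xs" using False subseq_set[OF uv(2)] hd_in_set by blast
    moreover have "last vs = last cs"
      using uv(1) False \<open>cs \<noteq> []\<close> by (metis last_ConsR last_appendR list.distinct(1))
    then have "last cs \<in> set ys" using False subseq_set[OF uv(3)] last_in_set by fastforce
    moreover have "b < last cs" using *(4) \<open>cs \<noteq> []\<close> by simp
    ultimately show ?thesis using assms by fastforce
  qed
qed (auto intro: contains_213_mono)

lemma contains_213_shift: "contains_213 m (map ((+) j) xs) \<longleftrightarrow> contains_213 m xs"
proof
  assume "contains_213 m (map ((+) j) xs)"
  then obtain b a cs where *: "length cs = m" "subseq (b # a # cs) (map ((+) j) xs)" "a < b"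
    "sorted_wrt (<) (b # cs)"
    unfolding contains_213_def by blast
  then obtain us where us: "subseq us xs" "b # a # cs = map ((+) j) us"
    by (elim subseq_mapE)
  show "contains_213 m xs"
    using us * unfolding contains_213_def by (fastforce simp: Cons_eq_map_conv sorted_wrt_map)
next
  assume "contains_213 m xs"
  then obtain b a cs where *: "length cs = m" "subseq (b # a # cs) xs" "a < b"
    "sorted_wrt (<) (b # cs)"
    unfolding contains_213_def by blast
  then show "contains_213 m (map ((+) j) xs)"
    unfolding contains_213_def using subseq_map[OF *(2), of "(+) j"]
    by (intro exI[of _ "j + b"] exI[of _ "j + a"] exI[of _ "map ((+) j) cs"])
      (auto simp: sorted_wrt_map)
qed

section \<open>Containment of the pattern 132\<close>

definition contains_132 :: "nat list \<Rightarrow> bool" where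
  "contains_132 xs \<longleftrightarrow> (\<exists>a b c. subseq [a, c, b] xs \<and> a < b \<and> b < c)"

lemma order_isomorphic_132:
  "order_isomorphic s [1, 3, 2] \<longleftrightarrow> (\<exists>a b c. s = [a, c, b] \<and> a < b \<and> b < c)"
proof
  assume iso: "order_isomorphic s [1, 3, 2]"
  then have "length s = Suc (Suc (Suc 0))" by (simp add: order_isomorphic_def)
  then obtain a b c where "s = [a, c, b]" by (auto simp: length_Suc_conv)
  with iso show "\<exists>a b c. s = [a, c, b] \<and> a < b \<and> b < c"
    by (auto simp: order_isomorphic_def All_less_Suc2 numeral_3_eq_3 numeral_2_eq_2)
qed (auto simp: order_isomorphic_def less_Suc_eq numeral_3_eq_3 numeral_2_eq_2)

lemma avoids_132_iff: "avoids xs [1, 3, 2] \<longleftrightarrow> \<not> contains_132 xs"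
  unfolding avoids_def order_isomorphic_132 contains_132_def by blast

lemma contains_132_Nil: "\<not> contains_132 []"
  by (simp add: contains_132_def)

text \<open>Entries \<open>x\<close> of \<open>xs\<close> and \<open>y\<close> of \<open>ys\<close>
  with \<open>x < y\<close> would form the occurrence \<open>x\<close>, \<open>N\<close>,
  \<open>y\<close>. Conversely, if the left block lies above the right one, an occurrence cannot
  have \<open>a\<close> on the left and \<open>b\<close> on the right, so it falls into one
  block.\<close>

lemma contains_132_append_max:
  assumes "distinct (xs @ N # ys)" "\<And>x. x \<in> set xs \<Longrightarrow> x < N" "\<And>y. y \<in> set ys \<Longrightarrow> y < N"
  shows "\<not> contains_132 (xs @ N # ys) \<longleftrightarrow>
    \<not> contains_132 xs \<and> \<not> contains_132 ys \<and> (\<forall>x\<in>set xs. \<forall>y\<in>set ys. y < x)"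
proof (intro iffI conjI ballI)
  assume *: "\<not> contains_132 (xs @ N # ys)"
  have "subseq xs (xs @ N # ys)" "subseq ys (xs @ N # ys)"
    by (auto simp: list_emb_append2)
  then show "\<not> contains_132 xs" "\<not> contains_132 ys"
    using * unfolding contains_132_def by (meson subseq_order.order_trans)+
  fix x y assume xy: "x \<in> set xs" "y \<in> set ys"
  then have "subseq ([x] @ [N, y]) (xs @ N # ys)"
    by (intro list_emb_append_mono) (auto simp: subseq_singleton_left)
  then have "subseq [x, N, y] (xs @ N # ys)" by simp
  then have "\<not> x < y" using * assms(3)[OF xy(2)] unfolding contains_132_def by blast
  moreover have "x \<noteq> y" using xy assms(1) by auto
  ultimately show "y < x" by simp
next
  assume *: "\<not> contains_132 xs \<and> \<not> contains_132 ys \<and> (\<forall>x\<in>set xs. \<forall>y\<in>set ys. y < x)"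
  show "\<not> contains_132 (xs @ N # ys)"
  proof
    assume "contains_132 (xs @ N # ys)"
    then obtain a b c where abc: "subseq [a, c, b] (xs @ N # ys)" "a < b" "b < c"
      unfolding contains_132_def by blast
    then obtain us vs where uv: "[a, c, b] = us @ vs" "subseq us xs" "subseq vs (N # ys)"
      unfolding subseq_append_iff by blast
    have vs: "set vs \<subseteq> insert N (set ys)" using subseq_set[OF uv(3)] by simp
    then have le: "y \<le> N" if "y \<in> set vs" for y using that assms(3) by (fastforce intro: less_imp_le)
    have us: "set us \<subseteq> set xs" using subseq_set[OF uv(2)] .
    have "prefix us [a, c, b]" using uv(1) by (rule prefixI)
    then have "us = [] \<or> us = [a] \<or> us = [a, c] \<or> us = [a, c, b]"
      by (auto simp: prefix_Cons)
    then consider "us = []" "vs = [a, c, b]" | "us = [a]" "vs = [c, b]" | "us = [a, c]" "vs = [b]"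
      | "us = [a, c, b]" "vs = []"
      using uv(1)[symmetric] by (elim disjE) simp_all
    then show False
    \<comment> \<open>In the first case \<open>a\<close> is below the maximum, so \<open>N\<close>
      cannot be matched and the occurrence lies in \<open>ys\<close>. In the two mixed cases
      \<open>b < c\<close> keeps \<open>b\<close> away from \<open>N\<close>, so \<open>b\<close> is
      in \<open>ys\<close> while \<open>a\<close> is in \<open>xs\<close>, against
      \<open>a < b\<close>.\<close>
    proof cases
      case 1
      then have "a \<noteq> N" using le[of b] abc by auto
      then have "subseq [a, c, b] ys" using 1 uv(3) by (simp add: subseq_Cons2_neq)
      then show ?thesis using * abc unfolding contains_132_def by blast
    next
      case 2
      then have "a \<in> set xs" "b \<in> set vs" "b < N" using us le[of c] abc by auto
      then show ?thesis using * abc vs by fastforce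
    next
      case 3
      then have "a \<in> set xs" "b \<in> set vs" "b < N" using us assms(2)[of c] abc by auto
      then show ?thesis using * abc vs by fastforce
    next
      case 4
      then show ?thesis using uv(2) * abc unfolding contains_132_def by blast
    qed
  qed
qed

lemma contains_132_shift: "contains_132 (map ((+) j) xs) \<longleftrightarrow> contains_132 xs"
proof
  assume "contains_132 (map ((+) j) xs)"
  then obtain a b c us where "a < b" "b < c" "subseq us xs" "[a, c, b] = map ((+) j) us"
    unfolding contains_132_def by (metis subseq_mapE)
  then show "contains_132 xs"
    unfolding contains_132_def by (fastforce simp: Cons_eq_map_conv)
next
  assume "contains_132 xs"
  then obtain a b c where *: "a < b" "b < c" "subseq [a, c, b] xs"
    unfolding contains_132_def by blast
  then show "contains_132 (map ((+) j) xs)"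
    unfolding contains_132_def using subseq_map[OF *(3), of "(+) j"]
    by (intro exI[of _ "j + a"] exI[of _ "j + b"] exI[of _ "j + c"]) auto
qed

section \<open>Decomposition of the avoiders at their maximum, and the resulting counts\<close>

definition dumont_avoiders :: "nat \<Rightarrow> nat \<Rightarrow> nat list set" where
  "dumont_avoiders m n =
     {p \<in> permutations_of_set {1..n}. dumont p \<and> \<not> contains_132 p \<and> \<not> contains_213 m p}"

lemma dumont_count_pattern_213:
  "dumont_count (pattern_213 (m + 2)) n = card (dumont_avoiders m n)"
  unfolding dumont_count_def dumont_avoiders_def avoids_pattern_213_iff avoids_132_iff ..

lemma dumont_avoiders_iff:
  "p \<in> dumont_avoiders m n \<longleftrightarrow>
     set p = {1..n} \<and> distinct p \<and> dumont p \<and> \<not> contains_132 p \<and> \<not> contains_213 m p"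
  by (auto simp: dumont_avoiders_def permutations_of_set_def)

lemma finite_dumont_avoiders: "finite (dumont_avoiders m n)"
  by (simp add: dumont_avoiders_def)

lemma length_dumont_avoiders: "p \<in> dumont_avoiders m n \<Longrightarrow> length p = n"
  by (auto simp: dumont_avoiders_iff dest: distinct_card)

lemma dumont_avoiders_empty: "dumont_avoiders m 0 = {[]}"
  by (auto simp: dumont_avoiders_iff dumont_Nil contains_132_Nil contains_213_Nil)

text \<open>The maximum \<open>Suc n\<close> is odd, hence last. Removing it costs the pattern its
  top letter, which lowers the index by one.\<close>

lemma dumont_avoiders_odd:
  assumes "even n"
  shows "dumont_avoiders (Suc m) (Suc n) = (\<lambda>p. p @ [Suc n]) ` dumont_avoiders m n"
proof (intro equalityI subsetI)
  fix p assume "p \<in> dumont_avoiders (Suc m) (Suc n)"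
  then have p: "set p = {1..Suc n}" "distinct p" "dumont p" "\<not> contains_132 p"
    "\<not> contains_213 (Suc m) p"
    by (auto simp: dumont_avoiders_iff)
  then have "Suc n \<in> set p" by simp
  then obtain us vs where uv: "p = us @ Suc n # vs" by (meson split_list)
  have "set us \<union> set vs = {1..Suc n} - {Suc n}" using p(1,2) uv by auto
  also have "\<dots> = {1..n}" by auto
  finally have sets: "set us \<union> set vs = {1..n}" .
  then have "set us \<subseteq> {1..n}" "set vs \<subseteq> {1..n}" by blast+
  then have lt: "x \<in> set us \<Longrightarrow> x < Suc n" "x \<in> set vs \<Longrightarrow> x < Suc n" for x
    by auto
  have "dumont us" "vs = []"
    using p(3) dumont_append_max_odd[of "Suc n" us vs] lt assms by (auto simp: uv)
  moreover have "\<not> contains_132 us"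
    using p(4) contains_132_append_max[of us "Suc n" vs] p(2) lt by (auto simp: uv)
  moreover have "\<not> contains_213 m us"
    using p(5) contains_213_snoc_max[of us "Suc n" m] lt \<open>vs = []\<close> by (auto simp: uv)
  ultimately have "us \<in> dumont_avoiders m n"
    using sets p(2) uv by (auto simp: dumont_avoiders_iff)
  then show "p \<in> (\<lambda>p. p @ [Suc n]) ` dumont_avoiders m n"
    using uv \<open>vs = []\<close> by auto
next
  fix p assume "p \<in> (\<lambda>p. p @ [Suc n]) ` dumont_avoiders m n"
  then obtain us where us: "p = us @ [Suc n]" "us \<in> dumont_avoiders m n" by auto
  then have lt: "x \<in> set us \<Longrightarrow> x < Suc n" for x by (auto simp: dumont_avoiders_iff)
  have dist: "distinct (us @ [Suc n])" using us lt by (auto simp: dumont_avoiders_iff)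
  show "p \<in> dumont_avoiders (Suc m) (Suc n)"
    using us dist lt dumont_append_max_odd[of "Suc n" us "[]"]
      contains_132_append_max[of us "Suc n" "[]"] contains_213_snoc_max[of us "Suc n" m] assms
    by (auto simp: dumont_avoiders_iff contains_132_Nil)
qed

lemma card_dumont_avoiders_odd:
  "even n \<Longrightarrow> card (dumont_avoiders (Suc m) (Suc n)) = card (dumont_avoiders m n)"
  by (simp add: dumont_avoiders_odd card_image inj_on_def)

text \<open>The entry \<open>x\<close> and its smaller successor form the descent.\<close>

lemma dumont_even_contains_21:
  assumes "dumont p" "x \<in> set p" "even x"
  shows "contains_213 0 p"
proof -
  obtain us vs where "p = us @ x # vs" using assms(2) by (meson split_list)
  moreover have "vs \<noteq> [] \<and> hd vs < x"
    using assms unfolding \<open>p = us @ x # vs\<close>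
  proof (induction us)
    case Nil
    then show ?case by (cases vs) (auto simp: dumont_simps)
  next
    case (Cons u us)
    then show ?case by (cases us) (auto simp: dumont_simps)
  qed
  ultimately have "subseq [x, hd vs] p" by (cases vs) (auto intro: subseq_drop_many)
  with \<open>vs \<noteq> [] \<and> hd vs < x\<close> show ?thesis unfolding contains_213_0 by blast
qed

text \<open>From length 2 on the even entry 2 is present and forces an occurrence of 21.\<close>

lemma dumont_avoiders_0: "dumont_avoiders 0 n = (if n = 0 then {[]} else if n = 1 then {[1]} else {})"
proof -
  have "p \<notin> dumont_avoiders 0 n" if "n \<ge> 2" for p
    using dumont_even_contains_21[of p 2] that by (auto simp: dumont_avoiders_iff)
  moreover have "dumont_avoiders 0 (Suc 0) = {[Suc 0]}"
    by (auto simp: dumont_avoiders_def dumont_simps contains_132_def contains_213_def split: if_splits)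
  ultimately show ?thesis
    by (auto simp: dumont_avoiders_empty)
qed

text \<open>Every positive number below an element of \<open>B\<close> is again in \<open>B\<close>,
  since in \<open>A\<close> it would have to exceed that element. Hence the two value blocks are
  intervals determined by the size of \<open>B\<close>.\<close>

lemma initial_segment_of_split:
  assumes "A \<union> B = {1..N}" "\<And>a b. a \<in> A \<Longrightarrow> b \<in> B \<Longrightarrow> b < a"
  shows "B = {1..card B}" "A = {Suc (card B)..N}"
proof -
  have fin: "finite B" using assms(1) by (metis finite_Un finite_atLeastAtMost)
  have down: "c \<in> B" if "b \<in> B" "c \<ge> 1" "c \<le> b" for b c
  proof -
    have "b \<le> N" using that assms(1) by auto
    then have "c \<in> A \<union> B" using that unfolding assms(1) by simp
    then show ?thesis using assms(2)[of c b] that by auto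
  qed
  \<comment> \<open>The value 0 makes the interval empty when \<open>B\<close> has no
    maximum.\<close>
  have B: "B = {1..(if B = {} then 0 else Max B)}"
  proof (cases "B = {}")
    case False
    have "B \<subseteq> {1..N}" using assms(1) by blast
    then have "B \<subseteq> {1..Max B}" using fin by auto
    moreover have "{1..Max B} \<subseteq> B" using down[OF Max_in[OF fin False]] by auto
    ultimately show ?thesis using False by simp
  qed simp
  then show B': "B = {1..card B}" by (metis card_atLeastAtMost diff_Suc_1)
  have "A \<inter> B = {}" using assms(2) by blast
  then have "A = {1..N} - B" using assms(1) by blast
  also have "\<dots> = {Suc (card B)..N}" by (subst B') auto
  finally show "A = {Suc (card B)..N}" .
qed

text \<open>Here \<open>j\<close> is the size of the right block \<open>vs\<close>, which is never
  empty, and \<open>j = N\<close> means an empty left block. The left block stands directly before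
  the maximum, so it has index \<open>m\<close>, while the right block keeps
  \<open>Suc m\<close>.\<close>

lemma dumont_avoiders_even:
  assumes "odd N"
  shows "dumont_avoiders (Suc m) (Suc N) =
    (\<lambda>(j, us, vs). map ((+) j) us @ Suc N # vs) `
      (SIGMA j:{j \<in> {1..N}. j = N \<or> even j}. dumont_avoiders m (N - j) \<times> dumont_avoiders (Suc m) j)"
    (is "_ = ?f ` ?S")
proof (intro equalityI subsetI)
  fix p assume "p \<in> dumont_avoiders (Suc m) (Suc N)"
  then have p: "set p = {1..Suc N}" "distinct p" "dumont p" "\<not> contains_132 p"
    "\<not> contains_213 (Suc m) p"
    by (auto simp: dumont_avoiders_iff)
  then have "Suc N \<in> set p" by simp
  then obtain us vs where uv: "p = us @ Suc N # vs" by (meson split_list)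
  have "set us \<union> set vs = {1..Suc N} - {Suc N}" using p(1,2) uv by auto
  also have "\<dots> = {1..N}" by auto
  finally have sets: "set us \<union> set vs = {1..N}" .
  then have "set us \<subseteq> {1..N}" "set vs \<subseteq> {1..N}" by blast+
  then have lt: "x \<in> set us \<Longrightarrow> x < Suc N" "x \<in> set vs \<Longrightarrow> x < Suc N" for x
    by auto
  have dum: "dumont us" "dumont vs" "vs \<noteq> []"
    using p(3) dumont_append_max_even[of "Suc N" us vs] lt assms by (auto simp: uv)
  have av: "\<not> contains_132 us" "\<not> contains_132 vs" and gt: "\<forall>x\<in>set us. \<forall>y\<in>set vs. y < x"
    using p(4) contains_132_append_max[of us "Suc N" vs] p(2) lt by (auto simp: uv)
  have "\<not> contains_213 (Suc m) (us @ [Suc N])" "\<not> contains_213 (Suc m) vs"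
    using p(5) contains_213_append[of "us @ [Suc N]" vs m] gt lt by (auto simp: uv)
  then have av': "\<not> contains_213 m us" "\<not> contains_213 (Suc m) vs"
    using contains_213_snoc_max[of us "Suc N" m] lt by auto
  define j where "j = card (set vs)"
  have sv: "set vs = {1..j}" and su: "set us = {Suc j..N}"
    using initial_segment_of_split[OF sets] gt unfolding j_def by blast+
  have j: "j \<in> {1..N}" using sv dum(3) sets by (cases "j = 0") force+
  \<comment> \<open>If the left block is nonempty, its least entry is \<open>Suc j\<close>, which an
    even value would contradict.\<close>
  have ev: "j = N \<or> even j"
  proof (rule ccontr)
    assume "\<not> (j = N \<or> even j)"
    then have "Suc j \<in> set us" "even (Suc j)" using j su by auto
    then show False using dumont_even_has_smaller[OF dum(1)] su by fastforce
  qed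
  define ws where "ws = map (\<lambda>x. x - j) us"
  have us: "us = map ((+) j) ws" unfolding ws_def map_map
    by (rule map_idI[symmetric]) (use su in auto)
  have "set ws = {1..N - j}"
  proof -
    have "(\<lambda>x. x - j) ` {Suc j..N} = {1..N - j}"
    proof (intro equalityI subsetI)
      fix x assume "x \<in> {1..N - j}"
      then show "x \<in> (\<lambda>x. x - j) ` {Suc j..N}" by (intro image_eqI[of _ _ "x + j"]) auto
    qed auto
    then show ?thesis by (simp add: ws_def su)
  qed
  moreover have "distinct ws" using p(2) unfolding uv us by (simp add: distinct_map)
  \<comment> \<open>For even \<open>j\<close> the shift is harmless. For \<open>j = N\<close>, which
    is odd, \<open>ws\<close> is empty.\<close>
  moreover have "dumont ws"
    using dum(1) ev dumont_shift[of j ws] \<open>set ws = {1..N - j}\<close> by (auto simp: us dumont_Nil)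
  ultimately have "ws \<in> dumont_avoiders m (N - j)"
    using av av' unfolding us contains_132_shift contains_213_shift by (simp add: dumont_avoiders_iff)
  moreover have "vs \<in> dumont_avoiders (Suc m) j"
    using sv p(2) dum av av' by (simp add: dumont_avoiders_iff uv)
  ultimately show "p \<in> ?f ` ?S"
    using j ev unfolding uv us by (intro image_eqI[of _ _ "(j, ws, vs)"]) auto
next
  fix p assume "p \<in> ?f ` ?S"
  then obtain j us vs where p: "p = map ((+) j) us @ Suc N # vs" and j: "1 \<le> j" "j \<le> N" "j = N \<or> even j"
    and us: "us \<in> dumont_avoiders m (N - j)" and vs: "vs \<in> dumont_avoiders (Suc m) j"
    by auto
  define ws where "ws = map ((+) j) us"
  have sv: "set vs = {1..j}" and su: "set us = {1..N - j}" using us vs by (auto simp: dumont_avoiders_iff)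
  have "set ws = {Suc j..N}"
    using j su by (simp add: ws_def)
  then have lt: "x \<in> set ws \<Longrightarrow> x < Suc N" "y \<in> set vs \<Longrightarrow> y < Suc N"
    "x \<in> set ws \<Longrightarrow> y \<in> set vs \<Longrightarrow> y < x" for x y
    using sv j by auto
  have "distinct ws" using us by (simp add: ws_def dumont_avoiders_iff distinct_map)
  then have dist: "distinct (ws @ Suc N # vs)"
    using vs sv \<open>set ws = {Suc j..N}\<close> j by (auto simp: dumont_avoiders_iff)
  have "vs \<noteq> []" using sv j by auto
  have "dumont ws"
    using j(3) us dumont_shift[of j us] by (auto simp: ws_def dumont_avoiders_iff dumont_Nil)
  then have "dumont (ws @ Suc N # vs)"
    using dumont_append_max_even[of "Suc N" ws vs] lt assms vs \<open>vs \<noteq> []\<close>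
    by (auto simp: dumont_avoiders_iff)
  moreover have "\<not> contains_132 (ws @ Suc N # vs)"
    using contains_132_append_max[OF dist] lt us vs contains_132_shift[of j us]
    by (auto simp: dumont_avoiders_iff ws_def)
  \<comment> \<open>The maximum is grouped with the left block, so that all entries of the first
    list exceed those of \<open>vs\<close>.\<close>
  moreover have "\<not> contains_213 (Suc m) ((ws @ [Suc N]) @ vs)"
  proof (subst contains_213_append)
    show "y < x" if "x \<in> set (ws @ [Suc N])" "y \<in> set vs" for x y
      using that lt(2,3) by auto
    show "\<not> (contains_213 (Suc m) (ws @ [Suc N]) \<or> contains_213 (Suc m) vs)"
      using contains_213_snoc_max[of ws "Suc N" m, OF lt(1)] contains_213_shift[of m j us] us vs
      by (simp add: dumont_avoiders_iff ws_def)
  qed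
  moreover have "set (ws @ Suc N # vs) = {1..Suc N}"
    using \<open>set ws = {Suc j..N}\<close> sv j by auto
  ultimately show "p \<in> dumont_avoiders (Suc m) (Suc N)"
    using dist by (simp add: dumont_avoiders_iff p ws_def)
qed

text \<open>The term \<open>j = N\<close> stands alone: \<open>N\<close> is odd, so the sum misses
  it, and its left factor counts only the empty list.\<close>

lemma card_dumont_avoiders_even:
  assumes "odd N"
  shows "card (dumont_avoiders (Suc m) (Suc N)) =
    card (dumont_avoiders (Suc m) N) +
    (\<Sum>j | j \<in> {1..N} \<and> even j. card (dumont_avoiders m (N - j)) * card (dumont_avoiders (Suc m) j))"
proof -
  let ?J = "{j. j \<in> {1..N} \<and> even j}"
  let ?f = "\<lambda>(j, us, vs). map ((+) j) us @ Suc N # vs"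
  let ?S = "SIGMA j:insert N ?J. dumont_avoiders m (N - j) \<times> dumont_avoiders (Suc m) j"
  have ins: "{j \<in> {1..N}. j = N \<or> even j} = insert N ?J" using assms by (auto elim: oddE)
  have "x = y" if "x \<in> ?S" "y \<in> ?S" "?f x = ?f y" for x y
  proof -
    obtain j us vs j' us' vs' where xy: "x = (j, us, vs)" "y = (j', us', vs')"
      by (metis prod.exhaust)
    have *: "map ((+) j) us @ Suc N # vs = map ((+) j') us' @ Suc N # vs'"
      "j \<in> insert N ?J" "us \<in> dumont_avoiders m (N - j)" "vs \<in> dumont_avoiders (Suc m) j"
      "vs' \<in> dumont_avoiders (Suc m) j'"
      using that by (auto simp: xy)
    then have "Suc N \<notin> set (map ((+) j) us)" "Suc N \<notin> set vs"
      by (auto simp: dumont_avoiders_iff)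
    \<comment> \<open>The maximum occurs only once, so it fixes where to cut. The shift
      \<open>j\<close> is then recovered as the length of \<open>vs\<close>.\<close>
    then have eq: "map ((+) j) us = map ((+) j') us'" "vs = vs'"
      using *(1) by (simp_all add: append_Cons_eq_iff)
    then have "j = j'" using length_dumont_avoiders *(4,5) by blast
    with eq show "x = y" by (simp add: xy inj_map_eq_map)
  qed
  then have "inj_on ?f ?S" by (intro inj_onI)
  then have "card (dumont_avoiders (Suc m) (Suc N)) = card ?S"
    unfolding dumont_avoiders_even[OF assms] ins by (rule card_image)
  also have "\<dots> = (\<Sum>j\<in>insert N ?J. card (dumont_avoiders m (N - j)) * card (dumont_avoiders (Suc m) j))"
    by (subst card_SigmaI) (auto simp: finite_dumont_avoiders card_cartesian_product)
  also have "\<dots> = card (dumont_avoiders (Suc m) N) +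
    (\<Sum>j\<in>?J. card (dumont_avoiders m (N - j)) * card (dumont_avoiders (Suc m) j))"
    by (subst sum.insert) (use assms in \<open>auto simp: dumont_avoiders_empty\<close>)
  finally show ?thesis .
qed

section \<open>Generating functions by parity of the length, and their identification with
  \<open>G\<close>\<close>

definition even_gf :: "nat \<Rightarrow> rat fps" where
  "even_gf m = Abs_fps (\<lambda>n. if even n then of_nat (card (dumont_avoiders m n)) else 0)"

definition odd_gf :: "nat \<Rightarrow> rat fps" where
  "odd_gf m = Abs_fps (\<lambda>n. if odd n then of_nat (card (dumont_avoiders m n)) else 0)"

lemma dumont_gf_pattern_213: "dumont_gf (pattern_213 (m + 2)) = even_gf m + odd_gf m"
  by (rule fps_ext) (simp add: dumont_gf_def even_gf_def odd_gf_def dumont_count_pattern_213 del: add_2_eq_Suc')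

lemma odd_gf_Suc: "odd_gf (Suc m) = fps_X * even_gf m"
proof (rule fps_ext)
  fix n show "odd_gf (Suc m) $ n = (fps_X * even_gf m) $ n"
    by (cases n) (auto simp: odd_gf_def even_gf_def card_dumont_avoiders_odd)
qed

lemma even_gf_0: "even_gf 0 = 1"
  by (rule fps_ext) (auto simp: even_gf_def dumont_avoiders_0)

lemma odd_gf_0: "odd_gf 0 = fps_X"
  by (rule fps_ext) (auto simp: odd_gf_def dumont_avoiders_0 fps_X_def)

text \<open>The summand 1 is the empty permutation, \<open>fps_X * odd_gf (Suc m)\<close> covers an
  empty left block, and the product covers a nonempty one. Subtracting 1 in the product excludes an
  empty right block.\<close>

lemma even_gf_Suc:
  "even_gf (Suc m) = 1 + fps_X * odd_gf (Suc m) + fps_X * ((even_gf (Suc m) - 1) * odd_gf m)"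
    (is "_ = ?R")
proof (rule fps_ext)
  fix n
  let ?c = "\<lambda>m n. of_nat (card (dumont_avoiders m n)) :: rat"
  have E: "(even_gf (Suc m) - 1) $ j = (if even j \<and> j \<noteq> 0 then ?c (Suc m) j else 0)" for j
    by (auto simp: even_gf_def dumont_avoiders_empty)
  show "even_gf (Suc m) $ n = ?R $ n"
  proof (cases n)
    case 0
    then show ?thesis by (simp add: even_gf_def dumont_avoiders_empty)
  next
    case (Suc N)
    have conv: "((even_gf (Suc m) - 1) * odd_gf m) $ N =
      (\<Sum>j=0..N. (if even j \<and> j \<noteq> 0 then ?c (Suc m) j else 0) *
        (if odd (N - j) then ?c m (N - j) else 0))"
      unfolding fps_mult_nth E by (simp add: odd_gf_def)
    show ?thesis
    proof (cases "odd N")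
      case True
      \<comment> \<open>For odd \<open>N\<close> and even \<open>j\<close> the difference
        \<open>N - j\<close> is automatically odd, so only the range of \<open>j\<close> has to be
        trimmed.\<close>
      have "((even_gf (Suc m) - 1) * odd_gf m) $ N =
        (\<Sum>j | j \<in> {1..N} \<and> even j. ?c m (N - j) * ?c (Suc m) j)"
        unfolding conv by (rule sum.mono_neutral_cong_right) (use True in auto)
      then show ?thesis
        using True Suc card_dumont_avoiders_even[OF True, of m]
        by (simp add: even_gf_def odd_gf_def)
    next
      case False
      \<comment> \<open>For even \<open>N\<close>, no \<open>j\<close> is even with
        \<open>N - j\<close> odd.\<close>
      then have "((even_gf (Suc m) - 1) * odd_gf m) $ N = 0"
        unfolding conv by (intro sum.neutral) auto
      then show ?thesis using False Suc by (simp add: even_gf_def odd_gf_def)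
    qed
  qed
qed

text \<open>Both parities go through one induction, because the equation for
  \<open>even_gf (Suc m)\<close> involves \<open>odd_gf m\<close> as well as
  \<open>odd_gf (Suc m)\<close>. Once these are known, it is linear in
  \<open>even_gf (Suc m)\<close>.\<close>

lemma even_odd_gf_eq_G: "even_gf m = G (Suc m) \<and> odd_gf m = fps_X * G m"
proof (induction m)
  case 0
  then show ?case by (simp add: even_gf_0 odd_gf_0)
next
  case (Suc m)
  let ?D = "1 - fps_X\<^sup>2 * G m"
  have odd: "odd_gf (Suc m) = fps_X * G (Suc m)" "odd_gf m = fps_X * G m"
    using Suc by (simp_all add: odd_gf_Suc)
  have "even_gf (Suc m) = 1 + fps_X * (fps_X * G (Suc m)) + fps_X * ((even_gf (Suc m) - 1) * (fps_X * G m))"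
    using even_gf_Suc[of m] unfolding odd .
  then have "(even_gf (Suc m) - 1) * ?D = fps_X\<^sup>2 * G (Suc m)"
    by algebra
  \<comment> \<open>The constant coefficient shows that the denominator is nonzero, which allows the
    division.\<close>
  moreover have "?D $ 0 = 1" by (simp add: power2_eq_square mult.assoc)
  then have "?D \<noteq> 0" by (metis fps_zero_nth zero_neq_one)
  ultimately have "even_gf (Suc m) - 1 = fps_X\<^sup>2 * G (Suc m) / ?D"
    by (metis fps_divide_times_eq)
  then have "even_gf (Suc m) = G (Suc (Suc m))"
    unfolding G.simps by (metis diff_add_cancel add.commute)
  with odd show ?case by simp
qed

theorem theorem2p8:
  fixes k :: nat
  assumes "k \<ge> 2"
  shows "dumont_gf (pattern_213 k) = G (k - 1) + fps_X * G (k - 2)"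
proof -
  obtain m where "k = m + 2" using assms by (metis add.commute le_Suc_ex)
  then show ?thesis using dumont_gf_pattern_213[of m] even_odd_gf_eq_G[of m] by simp
qed

end
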